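(* Let $(\boldsymbol{x},\boldsymbol{\nu}_1,\boldsymbol{\nu}_2):U\to H^3\times\Delta_5$ be a hyperbolic generalized framed surface with basic invariants $a_i,b_i,c_i,e_i,f_i,g_i$, $i=1,2$. (1) Assume there exists a smooth function $\theta:U\to\mathbb{R}$ such that $(a_1\cos\theta-b_1\sin\theta)(u,v)=0$ for all $(u,v)\in U$. (i) If $c_1(u,v)=0$ for all $(u,v)\in U$, then $\boldsymbol{x}$ is a one-parameter family of hyperbolic framed base curves with respect to $u$. (ii) If there exists a point $(u_0,v_0)\in U$ such that $c_1(u_0,v_0)\neq0$, then $\boldsymbol{x}$ is a one-parameter family of hyperbolic framed base curves with respect to $u$ at least locally around $(u_0,v_0)$. (2) Assume there exists a smooth function $\theta:U\to\mathbb{R}$ such that $(a_2\cos\theta-b_2\sin\theta)(u,v)=0$ for all $(u,v)\in U$. (i) If $c_2(u,v)=0$ for all $(u,v)\in U$, then $\boldsymbol{x}$ is a one-parameter family of hyperbolic framed base curves with respect to $v$. (ii) If there exists a point $(u_0,v_0)\in U$ such that $c_2(u_0,v_0)\neq0$, then $\boldsymbol{x}$ is a one-parameter family of hyperbolic framed base curves with respect to $v$ at least locally around $(u_0,v_0)$.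
   Context: $\mathbb{R}^4_1$ is $\mathbb{R}^4$ with the pseudo inner product $\langle \boldsymbol{x},\boldsymbol{y}\rangle=-x_1y_1+x_2y_2+x_3y_3+x_4y_4$. The pseudo vector product $\boldsymbol{x}\wedge\boldsymbol{y}\wedge\boldsymbol{z}$ of three vectors of $\mathbb{R}^4_1$ is the unique vector with $\langle \boldsymbol{w},\boldsymbol{x}\wedge\boldsymbol{y}\wedge\boldsymbol{z}\rangle=\det(\boldsymbol{w},\boldsymbol{x},\boldsymbol{y},\boldsymbol{z})$ for all $\boldsymbol{w}\in\mathbb{R}^4_1$. $H^3=\{\boldsymbol{x}\in\mathbb{R}^4_1: \langle\boldsymbol{x},\boldsymbol{x}\rangle=-1,\ x_1>0\}$, $S^3_1=\{\boldsymbol{x}\in\mathbb{R}^4_1:\langle\boldsymbol{x},\boldsymbol{x}\rangle=1\}$, $\Delta_5=\{(\boldsymbol{\nu}_1,\boldsymbol{\nu}_2)\in S^3_1\times S^3_1:\langle\boldsymbol{\nu}_1,\boldsymbol{\nu}_2\rangle=0\}$. $U$ is a simply connected open subset of $\mathbb{R}^2$ with coordinates $(u,v)$; subscripts $u,v$ denote partial derivatives; all maps are $C^\infty$. One-parameter family of hyperbolic framed curves with respect to $u$ (respectively $v$): a smooth map $(\boldsymbol{\gamma},\boldsymbol{\nu}_1,\boldsymbol{\nu}_2):U\to H^3\times\Delta_5$ with $\langle\boldsymbol{\gamma},\boldsymbol{\nu}_i\rangle=\langle\boldsymbol{\gamma}_u,\boldsymbol{\nu}_i\rangle=0$ (respectively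 $\langle\boldsymbol{\gamma},\boldsymbol{\nu}_i\rangle=\langle\boldsymbol{\gamma}_v,\boldsymbol{\nu}_i\rangle=0$) on $U$ for $i=1,2$. A smooth map $\boldsymbol{\gamma}:U\to H^3$ is a one-parameter family of hyperbolic framed base curves with respect to $u$ (respectively $v$) if there is a smooth $(\boldsymbol{\nu}_1,\boldsymbol{\nu}_2):U\to\Delta_5$ such that $(\boldsymbol{\gamma},\boldsymbol{\nu}_1,\boldsymbol{\nu}_2)$ is a one-parameter family of hyperbolic framed curves with respect to $u$ (respectively $v$). "At least locally around $(u_0,v_0)$" means that the restriction of $\boldsymbol{x}$ to some open neighbourhood of $(u_0,v_0)$ in $U$ has the property. Hyperbolic generalized framed surface: a smooth map $(\boldsymbol{x},\boldsymbol{\nu}_1,\boldsymbol{\nu}_2):U\to H^3\times\Delta_5$ with $\langle\boldsymbol{x},\boldsymbol{\nu}_1\rangle=\langle\boldsymbol{x},\boldsymbol{\nu}_2\rangle=0$ on $U$ for which there are smooth functions $\alpha,\beta:U\to\mathbb{R}$ with $\boldsymbol{x}\wedge\boldsymbol{x}_u\wedge\boldsymbol{x}_v=\alpha\boldsymbol{\nu}_1+\beta\boldsymbol{\nu}_2$ on $U$. With $\boldsymbol{\nu}_3=\boldsymbol{x}\wedge\boldsymbol{\nu}_1\wedge\boldsymbol{\nu}_2$, its basic invariants are the smooth functions given by $\boldsymbol{x}_u=a_1\boldsymbol{\nu}_1+b_1\boldsymbol{\nu}_2+c_1\boldsymbol{\nu}_3$, $\boldsymbol{\nu}_{1u}=a_1\boldsymbol{x}+e_1\boldsymbol{\nu}_2+f_1\boldsymbol{\nu}_3$,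 $\boldsymbol{\nu}_{2u}=b_1\boldsymbol{x}-e_1\boldsymbol{\nu}_1+g_1\boldsymbol{\nu}_3$, $\boldsymbol{\nu}_{3u}=c_1\boldsymbol{x}-f_1\boldsymbol{\nu}_1-g_1\boldsymbol{\nu}_2$, and the same formulas with $u$ replaced by $v$ and index $1$ by $2$. *)

theory Defs
  imports "HOL-Analysis.Analysis"
begin

section \<open>Smooth maps and partial derivatives\<close>

text \<open>The two notions below are meant for an open set \<open>S\<close>: \<open>at x\<close> is the unrestricted
  neighbourhood filter, so the values of \<open>f\<close> outside \<open>S\<close> do not matter.\<close>

fun times_differentiable_on ::
    "nat \<Rightarrow> ('a::real_normed_vector \<Rightarrow> 'b::real_normed_vector) \<Rightarrow> 'a set \<Rightarrow> bool" where
  "times_differentiable_on 0 f S \<longleftrightarrow> continuous_on S f"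
| "times_differentiable_on (Suc k) f S \<longleftrightarrow>
     (\<forall>x\<in>S. f differentiable (at x)) \<and>
     (\<forall>h. times_differentiable_on k (\<lambda>x. frechet_derivative f (at x) h) S)"

definition smooth_on ::
    "'a set \<Rightarrow> ('a::real_normed_vector \<Rightarrow> 'b::real_normed_vector) \<Rightarrow> bool" where
  "smooth_on S f \<longleftrightarrow> (\<forall>k. times_differentiable_on k f S)"

definition partial_u :: "(real \<times> real \<Rightarrow> 'b::real_normed_vector) \<Rightarrow> real \<times> real \<Rightarrow> 'b" where
  "partial_u f p = vector_derivative (\<lambda>s. f (s, snd p)) (at (fst p))"

definition partial_v :: "(real \<times> real \<Rightarrow> 'b::real_normed_vector) \<Rightarrow> real \<times> real \<Rightarrow> 'b" where
  "partial_v f p = vector_derivative (\<lambda>t. f (fst p, t)) (at (snd p))"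


section \<open>Lorentz-Minkowski 4-space\<close>

definition mink_inner :: "real^4 \<Rightarrow> real^4 \<Rightarrow> real" where
  "mink_inner x y = - (x$1 * y$1) + x$2 * y$2 + x$3 * y$3 + x$4 * y$4"

definition mink_wedge :: "real^4 \<Rightarrow> real^4 \<Rightarrow> real^4 \<Rightarrow> real^4" where
  "mink_wedge x y z = (THE n. \<forall>w. mink_inner w n = det (vector [w, x, y, z] :: real^4^4))"

lemma mink_inner_nondegenerate:
  assumes "\<And>w. mink_inner w m = mink_inner w n"
  shows "m = n"
proof -
  have "mink_inner (axis i 1) m = mink_inner (axis i 1) n" for i
    using assms by blast
  from this[of 1] this[of 2] this[of 3] this[of 4] show ?thesis
    by (simp add: mink_inner_def axis_def vec_eq_iff forall_4)
qed

text \<open>The defining property of the wedge product determines exactly one vector.\<close>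

lemma mink_wedge_ex1: "\<exists>!n. \<forall>w. mink_inner w n = det (vector [w, x, y, z] :: real^4^4)"
proof -
  define F where "F w = det (vector [w, x, y, z] :: real^4^4)" for w
  have row: "vector [w, x, y, z] = (\<chi> i. if i = (1::4) then w else (vector [0, x, y, z] :: real^4^4) $ i)" for w
    by (simp add: vec_eq_iff forall_4 vector_def)
  have add: "F (v + w) = F v + F w" for v w
    unfolding F_def row[of v] row[of w] row[of "v + w"] by (rule det_row_add)
  have mul: "F (c *s w) = c * F w" for c w
    unfolding F_def row[of w] row[of "c *s w"] by (rule det_row_mul)
  have lin: "F w = w$1 * F (axis 1 1) + w$2 * F (axis 2 1) + w$3 * F (axis 3 1) + w$4 * F (axis 4 1)" for w
  proof -
    have "w = w$1 *s axis 1 1 + w$2 *s axis 2 1 + w$3 *s axis 3 1 + w$4 *s axis 4 1"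
      by (simp add: vec_eq_iff forall_4 axis_def)
    then have "F w = F (w$1 *s axis 1 1 + w$2 *s axis 2 1 + w$3 *s axis 3 1 + w$4 *s axis 4 1)"
      by simp
    then show ?thesis by (simp only: add mul)
  qed
  define n :: "real^4" where "n = (\<chi> i. if i = 1 then - F (axis 1 1) else F (axis i 1))"
  have "mink_inner w n = F w" for w
    using lin[of w] by (simp add: mink_inner_def n_def)
  then show ?thesis
    unfolding F_def by (metis mink_inner_nondegenerate)
qed

lemma mink_inner_wedge: "mink_inner w (mink_wedge x y z) = det (vector [w, x, y, z] :: real^4^4)"
  using theI'[OF mink_wedge_ex1[of x y z]] unfolding mink_wedge_def by blast

definition hyperbolic_3_space :: "(real^4) set" where
  "hyperbolic_3_space = {x. mink_inner x x = -1 \<and> x$1 > 0}"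

definition de_sitter_3_space :: "(real^4) set" where
  "de_sitter_3_space = {x. mink_inner x x = 1}"

definition Delta5 :: "((real^4) \<times> (real^4)) set" where
  "Delta5 = {(n1, n2). n1 \<in> de_sitter_3_space \<and> n2 \<in> de_sitter_3_space \<and> mink_inner n1 n2 = 0}"


section \<open>Hyperbolic framed curves and generalized framed surfaces\<close>

text \<open>In the following, the argument \<open>D\<close> is \<open>partial_u\<close> (``with respect to u'') or
  \<open>partial_v\<close> (``with respect to v''), and \<open>U\<close> is an open set.\<close>

definition hyperbolic_framed_curve_family ::
  "((real \<times> real \<Rightarrow> real^4) \<Rightarrow> real \<times> real \<Rightarrow> real^4) \<Rightarrow> (real \<times> real) set \<Rightarrow>
   (real \<times> real \<Rightarrow> real^4) \<Rightarrow> (real \<times> real \<Rightarrow> real^4) \<Rightarrow> (real \<times> real \<Rightarrow> real^4) \<Rightarrow> bool" where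
  "hyperbolic_framed_curve_family D U \<gamma> \<nu>\<^sub>1 \<nu>\<^sub>2 \<longleftrightarrow>
     smooth_on U \<gamma> \<and> smooth_on U \<nu>\<^sub>1 \<and> smooth_on U \<nu>\<^sub>2 \<and>
     (\<forall>p\<in>U. \<gamma> p \<in> hyperbolic_3_space \<and> (\<nu>\<^sub>1 p, \<nu>\<^sub>2 p) \<in> Delta5 \<and>
        mink_inner (\<gamma> p) (\<nu>\<^sub>1 p) = 0 \<and> mink_inner (\<gamma> p) (\<nu>\<^sub>2 p) = 0 \<and>
        mink_inner (D \<gamma> p) (\<nu>\<^sub>1 p) = 0 \<and> mink_inner (D \<gamma> p) (\<nu>\<^sub>2 p) = 0)"

definition hyperbolic_framed_base_curve_family ::
  "((real \<times> real \<Rightarrow> real^4) \<Rightarrow> real \<times> real \<Rightarrow> real^4) \<Rightarrow> (real \<times> real) set \<Rightarrow>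
   (real \<times> real \<Rightarrow> real^4) \<Rightarrow> bool" where
  "hyperbolic_framed_base_curve_family D U \<gamma> \<longleftrightarrow>
     (\<exists>\<nu>\<^sub>1 \<nu>\<^sub>2. hyperbolic_framed_curve_family D U \<gamma> \<nu>\<^sub>1 \<nu>\<^sub>2)"

definition hyperbolic_framed_base_curve_family_near ::
  "((real \<times> real \<Rightarrow> real^4) \<Rightarrow> real \<times> real \<Rightarrow> real^4) \<Rightarrow> (real \<times> real) set \<Rightarrow>
   (real \<times> real \<Rightarrow> real^4) \<Rightarrow> real \<times> real \<Rightarrow> bool" where
  "hyperbolic_framed_base_curve_family_near D U \<gamma> p \<longleftrightarrow>
     (\<exists>V. open V \<and> p \<in> V \<and> V \<subseteq> U \<and> hyperbolic_framed_base_curve_family D V \<gamma>)"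

definition hyperbolic_generalized_framed_surface ::
  "(real \<times> real) set \<Rightarrow> (real \<times> real \<Rightarrow> real^4) \<Rightarrow> (real \<times> real \<Rightarrow> real^4) \<Rightarrow>
   (real \<times> real \<Rightarrow> real^4) \<Rightarrow> bool" where
  "hyperbolic_generalized_framed_surface U x \<nu>\<^sub>1 \<nu>\<^sub>2 \<longleftrightarrow>
     smooth_on U x \<and> smooth_on U \<nu>\<^sub>1 \<and> smooth_on U \<nu>\<^sub>2 \<and>
     (\<forall>p\<in>U. x p \<in> hyperbolic_3_space \<and> (\<nu>\<^sub>1 p, \<nu>\<^sub>2 p) \<in> Delta5 \<and>
        mink_inner (x p) (\<nu>\<^sub>1 p) = 0 \<and> mink_inner (x p) (\<nu>\<^sub>2 p) = 0) \<and>
     (\<exists>\<alpha> \<beta> :: real \<times> real \<Rightarrow> real. smooth_on U \<alpha> \<and> smooth_on U \<beta> \<and>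
        (\<forall>p\<in>U. mink_wedge (x p) (partial_u x p) (partial_v x p)
                 = \<alpha> p *\<^sub>R \<nu>\<^sub>1 p + \<beta> p *\<^sub>R \<nu>\<^sub>2 p))"

definition framed_surface_normal3 ::
  "(real \<times> real \<Rightarrow> real^4) \<Rightarrow> (real \<times> real \<Rightarrow> real^4) \<Rightarrow> (real \<times> real \<Rightarrow> real^4) \<Rightarrow>
   real \<times> real \<Rightarrow> real^4" where
  "framed_surface_normal3 x \<nu>\<^sub>1 \<nu>\<^sub>2 p = mink_wedge (x p) (\<nu>\<^sub>1 p) (\<nu>\<^sub>2 p)"

text \<open>The invariants with index 1 belong to \<open>D = partial_u\<close>, those with index 2 to
  \<open>D = partial_v\<close>.\<close>

definition basic_invariants_wrt ::
  "((real \<times> real \<Rightarrow> real^4) \<Rightarrow> real \<times> real \<Rightarrow> real^4) \<Rightarrow> (real \<times> real) set \<Rightarrow>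
   (real \<times> real \<Rightarrow> real^4) \<Rightarrow> (real \<times> real \<Rightarrow> real^4) \<Rightarrow> (real \<times> real \<Rightarrow> real^4) \<Rightarrow>
   (real \<times> real \<Rightarrow> real) \<Rightarrow> (real \<times> real \<Rightarrow> real) \<Rightarrow> (real \<times> real \<Rightarrow> real) \<Rightarrow>
   (real \<times> real \<Rightarrow> real) \<Rightarrow> (real \<times> real \<Rightarrow> real) \<Rightarrow> (real \<times> real \<Rightarrow> real) \<Rightarrow> bool" where
  "basic_invariants_wrt D U x \<nu>\<^sub>1 \<nu>\<^sub>2 a b c e f g \<longleftrightarrow>
     smooth_on U a \<and> smooth_on U b \<and> smooth_on U c \<and>
     smooth_on U e \<and> smooth_on U f \<and> smooth_on U g \<and>
     (let \<nu>\<^sub>3 = framed_surface_normal3 x \<nu>\<^sub>1 \<nu>\<^sub>2 in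
      \<forall>p\<in>U.
        D x p = a p *\<^sub>R \<nu>\<^sub>1 p + b p *\<^sub>R \<nu>\<^sub>2 p + c p *\<^sub>R \<nu>\<^sub>3 p \<and>
        D \<nu>\<^sub>1 p = a p *\<^sub>R x p + e p *\<^sub>R \<nu>\<^sub>2 p + f p *\<^sub>R \<nu>\<^sub>3 p \<and>
        D \<nu>\<^sub>2 p = b p *\<^sub>R x p - e p *\<^sub>R \<nu>\<^sub>1 p + g p *\<^sub>R \<nu>\<^sub>3 p \<and>
        D \<nu>\<^sub>3 p = c p *\<^sub>R x p - f p *\<^sub>R \<nu>\<^sub>1 p - g p *\<^sub>R \<nu>\<^sub>2 p)"

end

theory Submission
  imports Defs
begin

text \<open>
  Let \<open>D\<close> stand for the partial derivative in question, and write
  \<open>D x = a \<nu>\<^sub>1 + b \<nu>\<^sub>2 + c \<nu>\<^sub>3\<close>.  Since \<open>x, \<nu>\<^sub>1, \<nu>\<^sub>2, \<nu>\<^sub>3\<close> is a pseudo-orthonormal frame with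
  timelike vector \<open>x\<close>, the problem is to find two smooth orthonormal sections of the
  spacelike 3-plane spanned by \<open>\<nu>\<^sub>1, \<nu>\<^sub>2, \<nu>\<^sub>3\<close> that are orthogonal to \<open>D x\<close>.  The hypothesis on \<open>\<theta>\<close>
  says that the first one can be taken to be \<open>n\<^sub>1 = cos \<theta> \<nu>\<^sub>1 - sin \<theta> \<nu>\<^sub>2\<close>.  Its orthogonal complement
  in the 3-plane is spanned by \<open>m = sin \<theta> \<nu>\<^sub>1 + cos \<theta> \<nu>\<^sub>2\<close> and \<open>\<nu>\<^sub>3\<close>, and there \<open>D x\<close> has the
  coordinates \<open>l = a sin \<theta> + b cos \<theta>\<close> and \<open>c\<close>.  So the second section has to be a unit vector
  \<open>\<kappa> m + \<mu> \<nu>\<^sub>3\<close> with \<open>\<kappa> l + \<mu> c = 0\<close>; that every such choice works is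
  \<open>hyperbolic_framed_base_curve_familyI\<close>.

  If \<open>c\<close> vanishes identically, \<open>\<nu>\<^sub>3\<close> itself is such a section, even at the zeros of \<open>l\<close>.  If
  \<open>c\<close> does not vanish at a point, then \<open>(\<kappa>, \<mu>)\<close> is \<open>(c, -l)\<close> divided by its length, which is
  smooth on the open set where \<open>c\<close> is nonzero.  The argument is the same for both partial
  derivatives, so \<open>generalized_framed_surface_framed_base_curves\<close> is stated for an arbitrary \<open>D\<close>.

  Two things support this argument: smooth maps are closed under algebraic operations, sine,
  cosine and real powers of positive functions; and \<open>\<nu>\<^sub>3\<close>, a pseudo vector product, is smooth and
  completes the frame, its length being given by a Gram determinant.
\<close>

section \<open>Calculus of smooth maps\<close>

lemma times_differentiable_on_cong:
  assumes "open S" "\<And>x. x \<in> S \<Longrightarrow> f x = g x"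
  shows "times_differentiable_on k f S \<longleftrightarrow> times_differentiable_on k g S"
  using assms(2)
proof (induction k arbitrary: f g)
  case 0
  then show ?case by (simp cong: continuous_on_cong)
next
  case (Suc k)
  have D: "(f has_derivative D) (at x) \<longleftrightarrow> (g has_derivative D) (at x)" if "x \<in> S" for x D
    using has_derivative_transform_within_open[OF _ \<open>open S\<close> that, of f D UNIV g]
      has_derivative_transform_within_open[OF _ \<open>open S\<close> that, of g D UNIV f] Suc.prems
    by auto
  then have "frechet_derivative f (at x) = frechet_derivative g (at x)" if "x \<in> S" for x
    using that by (simp add: frechet_derivative_def)
  then have "times_differentiable_on k (\<lambda>x. frechet_derivative f (at x) h) S
      \<longleftrightarrow> times_differentiable_on k (\<lambda>x. frechet_derivative g (at x) h) S" for h
    by (intro Suc.IH) simp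
  then show ?case
    using D by (simp add: differentiable_def)
qed

lemma times_differentiable_on_Suc_imp:
  "times_differentiable_on (Suc k) f S \<Longrightarrow> times_differentiable_on k f S"
proof (induction k arbitrary: f)
  case 0
  then show ?case
    by (auto intro!: continuous_at_imp_continuous_on differentiable_imp_continuous_within)
next
  case (Suc k)
  then show ?case
    by (metis times_differentiable_on.simps(2))
qed

text \<open>The recursion speaks about \<^const>\<open>frechet_derivative\<close>, a choice operator; this rule replaces
  it by any derivative \<open>D\<close> in closed form, so that closure properties follow by induction from
  the classical differentiation rules.\<close>

lemma times_differentiable_on_SucI:
  assumes "open S" "\<And>x. x \<in> S \<Longrightarrow> (f has_derivative D x) (at x)"
    and "\<And>h. times_differentiable_on k (\<lambda>x. D x h) S"
  shows "times_differentiable_on (Suc k) f S"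
proof -
  have "frechet_derivative f (at x) = D x" if "x \<in> S" for x
    using frechet_derivative_at[OF assms(2)[OF that]] by simp
  then have "times_differentiable_on k (\<lambda>x. frechet_derivative f (at x) h) S" for h
    using assms(3)[of h]
    by (subst times_differentiable_on_cong[OF \<open>open S\<close>, where g = "\<lambda>x. D x h"]) auto
  then show ?thesis
    using assms(2) by (auto simp: differentiable_def)
qed

lemma times_differentiable_on_SucD:
  assumes "times_differentiable_on (Suc k) f S"
  shows "x \<in> S \<Longrightarrow> (f has_derivative frechet_derivative f (at x)) (at x)"
    and "times_differentiable_on k (\<lambda>x. frechet_derivative f (at x) h) S"
  using assms by (auto simp: frechet_derivative_works)

lemma times_differentiable_on_const:
  "open S \<Longrightarrow> times_differentiable_on k (\<lambda>x. c) S"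
proof (induction k arbitrary: c)
  case (Suc k)
  then show ?case
    by (intro times_differentiable_on_SucI[where D = "\<lambda>x h. 0"]) auto
qed simp

lemma times_differentiable_on_add:
  assumes "open S"
  shows "times_differentiable_on k f S \<Longrightarrow> times_differentiable_on k g S
    \<Longrightarrow> times_differentiable_on k (\<lambda>x. f x + g x) S"
proof (induction k arbitrary: f g)
  case (Suc k)
  show ?case
    by (rule times_differentiable_on_SucI[OF \<open>open S\<close>,
          where D = "\<lambda>x h. frechet_derivative f (at x) h + frechet_derivative g (at x) h"])
      (intro has_derivative_add Suc.IH times_differentiable_on_SucD[OF Suc.prems(1)]
        times_differentiable_on_SucD[OF Suc.prems(2)]; assumption)+
qed (simp add: continuous_on_add)

lemma times_differentiable_on_scaleR:
  assumes "open S"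
  shows "times_differentiable_on k f S \<Longrightarrow> times_differentiable_on k g S
    \<Longrightarrow> times_differentiable_on k (\<lambda>x. f x *\<^sub>R g x) S"
proof (induction k arbitrary: f g)
  case (Suc k)
  note f = times_differentiable_on_SucD[OF Suc.prems(1)]
    and g = times_differentiable_on_SucD[OF Suc.prems(2)]
  show ?case
  proof (rule times_differentiable_on_SucI[OF \<open>open S\<close>])
    show "((\<lambda>x. f x *\<^sub>R g x) has_derivative
        (\<lambda>h. f x *\<^sub>R frechet_derivative g (at x) h + frechet_derivative f (at x) h *\<^sub>R g x)) (at x)"
      if "x \<in> S" for x
      using f(1)[OF that] g(1)[OF that] by (rule has_derivative_scaleR)
    show "times_differentiable_on k
        (\<lambda>x. f x *\<^sub>R frechet_derivative g (at x) h + frechet_derivative f (at x) h *\<^sub>R g x) S" for h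
      by (intro times_differentiable_on_add[OF \<open>open S\<close>] Suc.IH f(2) g(2)
          times_differentiable_on_Suc_imp[OF Suc.prems(1)]
          times_differentiable_on_Suc_imp[OF Suc.prems(2)])
  qed
qed (simp add: continuous_on_scaleR)

lemma times_differentiable_on_bounded_linear:
  assumes "open S" "bounded_linear L"
  shows "times_differentiable_on k f S \<Longrightarrow> times_differentiable_on k (\<lambda>x. L (f x)) S"
proof (induction k arbitrary: f)
  case 0
  then show ?case
    using assms(2) by (simp add: bounded_linear.continuous_on)
next
  case (Suc k)
  note f = times_differentiable_on_SucD[OF Suc.prems]
  show ?case
    by (rule times_differentiable_on_SucI[OF \<open>open S\<close>,
          where D = "\<lambda>x h. L (frechet_derivative f (at x) h)"])
      (auto intro: bounded_linear.has_derivative[OF assms(2)] f Suc.IH)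
qed

text \<open>By the chain rule, the derivative of \<open>\<phi> \<circ> f\<close> is \<open>\<psi> \<circ> f\<close>, with \<open>\<psi>\<close> the derivative of \<open>\<phi>\<close>,
  times the derivative of \<open>f\<close>.  Hence the induction on the order must treat \<open>\<phi>\<close> and all of its
  derivatives together.  A set \<open>F\<close> of functions that is closed under differentiation on \<open>I\<close> does
  this without a formula for the higher derivatives.\<close>

lemma times_differentiable_on_compose:
  fixes f :: "'a::real_normed_vector \<Rightarrow> real" and F :: "(real \<Rightarrow> real) set"
  assumes "open S" "\<And>x. x \<in> S \<Longrightarrow> f x \<in> I"
    and F: "\<And>\<phi>. \<phi> \<in> F \<Longrightarrow> \<exists>\<psi>\<in>F. \<forall>t\<in>I. (\<phi> has_real_derivative \<psi> t) (at t)"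
  shows "\<phi> \<in> F \<Longrightarrow> times_differentiable_on k f S
    \<Longrightarrow> times_differentiable_on k (\<lambda>x. \<phi> (f x)) S"
proof (induction k arbitrary: \<phi>)
  case 0
  have "isCont \<phi> t" if "t \<in> I" for t
    using F[OF \<open>\<phi> \<in> F\<close>] that DERIV_isCont by blast
  then have "continuous_on I \<phi>"
    by (simp add: continuous_at_imp_continuous_on)
  then show ?case
    using 0 assms(2) by (auto intro: continuous_on_compose2)
next
  case (Suc k)
  obtain \<psi> where "\<psi> \<in> F" and \<psi>: "\<And>t. t \<in> I \<Longrightarrow> (\<phi> has_real_derivative \<psi> t) (at t)"
    using F[OF \<open>\<phi> \<in> F\<close>] by blast
  note f = times_differentiable_on_SucD[OF Suc.prems(2)]
  show ?case
  proof (rule times_differentiable_on_SucI[OF \<open>open S\<close>])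
    show "((\<lambda>x. \<phi> (f x)) has_derivative (\<lambda>h. \<psi> (f x) *\<^sub>R frechet_derivative f (at x) h)) (at x)"
      if "x \<in> S" for x
      using has_derivative_compose[OF f(1)[OF that]
          \<psi>[OF assms(2)[OF that], unfolded has_field_derivative_def]]
      by simp
    show "times_differentiable_on k (\<lambda>x. \<psi> (f x) *\<^sub>R frechet_derivative f (at x) h) S" for h
      by (intro times_differentiable_on_scaleR[OF \<open>open S\<close>] f(2)
          Suc.IH[OF \<open>\<psi> \<in> F\<close> times_differentiable_on_Suc_imp[OF Suc.prems(2)]])
  qed
qed

lemma times_differentiable_on_subset:
  "times_differentiable_on k f S \<Longrightarrow> T \<subseteq> S \<Longrightarrow> times_differentiable_on k f T"
  by (induction k arbitrary: f) (auto intro: continuous_on_subset)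

lemma smooth_on_subset: "smooth_on S f \<Longrightarrow> T \<subseteq> S \<Longrightarrow> smooth_on T f"
  unfolding smooth_on_def using times_differentiable_on_subset by blast

lemma smooth_on_imp_continuous_on: "smooth_on S f \<Longrightarrow> continuous_on S f"
  unfolding smooth_on_def using times_differentiable_on.simps(1) by blast

lemma smooth_on_const: "open S \<Longrightarrow> smooth_on S (\<lambda>x. c)"
  by (simp add: smooth_on_def times_differentiable_on_const)

lemma smooth_on_add:
  "open S \<Longrightarrow> smooth_on S f \<Longrightarrow> smooth_on S g \<Longrightarrow> smooth_on S (\<lambda>x. f x + g x)"
  by (simp add: smooth_on_def times_differentiable_on_add)

lemma smooth_on_scaleR:
  "open S \<Longrightarrow> smooth_on S f \<Longrightarrow> smooth_on S g \<Longrightarrow> smooth_on S (\<lambda>x. f x *\<^sub>R g x)"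
  by (simp add: smooth_on_def times_differentiable_on_scaleR)

lemma smooth_on_mult:
  fixes f g :: "'a::real_normed_vector \<Rightarrow> real"
  shows "open S \<Longrightarrow> smooth_on S f \<Longrightarrow> smooth_on S g \<Longrightarrow> smooth_on S (\<lambda>x. f x * g x)"
  using smooth_on_scaleR[of S f g] by simp

lemma smooth_on_minus:
  "open S \<Longrightarrow> smooth_on S f \<Longrightarrow> smooth_on S (\<lambda>x. - f x)"
  using smooth_on_scaleR[OF _ smooth_on_const, of S f "-1"] by simp

lemma smooth_on_diff:
  "open S \<Longrightarrow> smooth_on S f \<Longrightarrow> smooth_on S g \<Longrightarrow> smooth_on S (\<lambda>x. f x - g x)"
  using smooth_on_add[OF _ _ smooth_on_minus, of S f g] by simp

lemma smooth_on_vec_nth: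
  assumes "open S" "smooth_on S f"
  shows "smooth_on S (\<lambda>x. f x $ i)"
  using assms times_differentiable_on_bounded_linear[OF _ bounded_linear_vec_nth]
  unfolding smooth_on_def by blast

lemma smooth_on_vector_4:
  fixes f1 f2 f3 f4 :: "'a::real_normed_vector \<Rightarrow> real"
  assumes "open S" "smooth_on S f1" "smooth_on S f2" "smooth_on S f3" "smooth_on S f4"
  shows "smooth_on S (\<lambda>x. vector [f1 x, f2 x, f3 x, f4 x] :: real^4)"
proof -
  have "(\<lambda>x. vector [f1 x, f2 x, f3 x, f4 x] :: real^4)
      = (\<lambda>x. f1 x *\<^sub>R axis 1 1 + f2 x *\<^sub>R axis 2 1 + f3 x *\<^sub>R axis 3 1 + f4 x *\<^sub>R axis 4 1)"
    by (simp add: fun_eq_iff vec_eq_iff forall_4 axis_def vector_def)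
  then show ?thesis
    by (simp only:) (intro assms smooth_on_add smooth_on_scaleR smooth_on_const)
qed

lemma smooth_on_compose:
  fixes f :: "'a::real_normed_vector \<Rightarrow> real" and F :: "(real \<Rightarrow> real) set"
  assumes "open S" "smooth_on S f" "\<And>x. x \<in> S \<Longrightarrow> f x \<in> I"
    and "\<And>\<phi>. \<phi> \<in> F \<Longrightarrow> \<exists>\<psi>\<in>F. \<forall>t\<in>I. (\<phi> has_real_derivative \<psi> t) (at t)"
    and "\<phi> \<in> F"
  shows "smooth_on S (\<lambda>x. \<phi> (f x))"
  using assms times_differentiable_on_compose[where F = F] unfolding smooth_on_def by blast

lemma smooth_on_sin_cos:
  fixes \<theta> :: "'a::real_normed_vector \<Rightarrow> real"
  assumes "open S" "smooth_on S \<theta>"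
  shows "smooth_on S (\<lambda>x. sin (\<theta> x))" "smooth_on S (\<lambda>x. cos (\<theta> x))"
proof -
  \<comment> \<open>The linear span of sine and cosine is closed under differentiation.\<close>
  let ?F = "range (\<lambda>(r, s) t :: real. r * sin t + s * cos t)"
  have F: "\<exists>\<psi>\<in>?F. \<forall>t\<in>UNIV. (\<phi> has_real_derivative \<psi> t) (at t)" if "\<phi> \<in> ?F" for \<phi>
  proof -
    obtain r s where "\<phi> = (\<lambda>t. r * sin t + s * cos t)"
      using \<open>\<phi> \<in> ?F\<close> by auto
    then have "(\<phi> has_real_derivative (- s) * sin t + r * cos t) (at t)" for t
      by (auto intro!: derivative_eq_intros)
    moreover have "(\<lambda>t. (- s) * sin t + r * cos t) \<in> ?F"
      by (rule image_eqI[where x = "(- s, r)"]) simp_all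
    ultimately show ?thesis
      by (intro bexI[rotated] ballI)
  qed
  have "sin \<in> ?F" "cos \<in> ?F"
    using image_eqI[of sin "\<lambda>(r, s) t. r * sin t + s * cos t" "(1, 0)" UNIV]
      image_eqI[of cos "\<lambda>(r, s) t. r * sin t + s * cos t" "(0, 1)" UNIV] by auto
  then show "smooth_on S (\<lambda>x. sin (\<theta> x))" "smooth_on S (\<lambda>x. cos (\<theta> x))"
    using smooth_on_compose[OF assms UNIV_I F] by blast+
qed

lemma smooth_on_powr:
  fixes f :: "'a::real_normed_vector \<Rightarrow> real"
  assumes "open S" "smooth_on S f" "\<And>x. x \<in> S \<Longrightarrow> f x > 0"
  shows "smooth_on S (\<lambda>x. f x powr s)"
proof -
  \<comment> \<open>The exponent drops by one with each derivative, so all exponents are needed together.\<close>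
  let ?F = "range (\<lambda>(c, s) t :: real. c * t powr s)"
  have F: "\<exists>\<psi>\<in>?F. \<forall>t\<in>{0<..}. (\<phi> has_real_derivative \<psi> t) (at t)" if "\<phi> \<in> ?F" for \<phi>
  proof -
    obtain c s where "\<phi> = (\<lambda>t. c * t powr s)"
      using \<open>\<phi> \<in> ?F\<close> by auto
    then have "(\<phi> has_real_derivative (c * s) * t powr (s - 1)) (at t)" if "t > 0" for t
      using that by (auto intro!: derivative_eq_intros simp: powr_diff)
    moreover have "(\<lambda>t. (c * s) * t powr (s - 1)) \<in> ?F"
      by (rule image_eqI[where x = "(c * s, s - 1)"]) simp_all
    ultimately show ?thesis
      by (intro bexI[rotated] ballI) simp_all
  qed
  have "(\<lambda>t. t powr s) \<in> ?F"
    using image_eqI[of "\<lambda>t. t powr s" "\<lambda>(c, s) t. c * t powr s" "(1, s)" UNIV] by auto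
  then show ?thesis
    using smooth_on_compose[OF assms(1,2) _ F, of "\<lambda>t. t powr s"] assms(3) by simp
qed

section \<open>The pseudo vector product\<close>

lemma det_vector_4:
  fixes w x y z :: "real^4"
  shows "det (vector [w, x, y, z] :: real^4^4) =
    w$1 * (x$2 * (y$3 * z$4 - y$4 * z$3) - x$3 * (y$2 * z$4 - y$4 * z$2) + x$4 * (y$2 * z$3 - y$3 * z$2))
  - w$2 * (x$1 * (y$3 * z$4 - y$4 * z$3) - x$3 * (y$1 * z$4 - y$4 * z$1) + x$4 * (y$1 * z$3 - y$3 * z$1))
  + w$3 * (x$1 * (y$2 * z$4 - y$4 * z$2) - x$2 * (y$1 * z$4 - y$4 * z$1) + x$4 * (y$1 * z$2 - y$2 * z$1))
  - w$4 * (x$1 * (y$2 * z$3 - y$3 * z$2) - x$2 * (y$1 * z$3 - y$3 * z$1) + x$3 * (y$1 * z$2 - y$2 * z$1))"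
proof -
  have f1234: "finite {2::4, 3, 4}" "1 \<notin> {2::4, 3, 4}" by auto
  have f234: "finite {3::4, 4}" "2 \<notin> {3::4, 4}" by auto
  have f34: "finite {4::4}" "3 \<notin> {4::4}" by auto
  have A: "(vector [w, x, y, z] :: real^4^4) $ 1 = w" "(vector [w, x, y, z] :: real^4^4) $ 2 = x"
    "(vector [w, x, y, z] :: real^4^4) $ 3 = y" "(vector [w, x, y, z] :: real^4^4) $ 4 = z"
    by (simp_all add: vector_def)
  show ?thesis
    unfolding det_def UNIV_4
    unfolding sum_over_permutations_insert[OF f1234]
    unfolding sum_over_permutations_insert[OF f234]
    unfolding sum_over_permutations_insert[OF f34]
    unfolding permutes_sing
    by (simp add: sign_swap_id permutation_swap_id permutation_compose sign_compose sign_id swap_id_eq A transpose_def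
        algebra_simps)
qed

text \<open>Expanding the determinant along its first row gives coordinates of the product; the first
  one changes its sign, because the first coordinate is the timelike one.  Polynomial coordinates
  make the product of smooth maps smooth.\<close>

lemma mink_wedge_eq:
  "mink_wedge x y z = vector
    [- (x$2 * (y$3 * z$4 - y$4 * z$3) - x$3 * (y$2 * z$4 - y$4 * z$2) + x$4 * (y$2 * z$3 - y$3 * z$2)),
     - (x$1 * (y$3 * z$4 - y$4 * z$3) - x$3 * (y$1 * z$4 - y$4 * z$1) + x$4 * (y$1 * z$3 - y$3 * z$1)),
     x$1 * (y$2 * z$4 - y$4 * z$2) - x$2 * (y$1 * z$4 - y$4 * z$1) + x$4 * (y$1 * z$2 - y$2 * z$1),
     - (x$1 * (y$2 * z$3 - y$3 * z$2) - x$2 * (y$1 * z$3 - y$3 * z$1) + x$3 * (y$1 * z$2 - y$2 * z$1))]"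
    (is "_ = ?n")
proof (rule mink_inner_nondegenerate)
  fix w
  show "mink_inner w (mink_wedge x y z) = mink_inner w ?n"
    unfolding mink_inner_wedge det_vector_4 by (simp add: mink_inner_def vector_def algebra_simps)
qed

lemma smooth_on_mink_wedge:
  assumes "open S" "smooth_on S x" "smooth_on S y" "smooth_on S z"
  shows "smooth_on S (\<lambda>p. mink_wedge (x p) (y p) (z p))"
  unfolding mink_wedge_eq
  by (intro smooth_on_vector_4 smooth_on_minus smooth_on_diff smooth_on_add smooth_on_mult smooth_on_vec_nth assms)

lemma mink_inner_wedge_self:
  "mink_inner x (mink_wedge x y z) = 0"
  "mink_inner y (mink_wedge x y z) = 0"
  "mink_inner z (mink_wedge x y z) = 0"
  unfolding mink_inner_wedge det_vector_4 by (simp_all add: algebra_simps)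

text \<open>The Lorentzian form of Lagrange's identity: the right-hand side is minus the Gram determinant
  of \<open>x, y, z\<close>.  For a timelike unit vector \<open>x\<close> and orthonormal spacelike \<open>y, z\<close> orthogonal to it
  that determinant is \<open>-1\<close>, so the product is a spacelike unit vector.\<close>

lemma mink_inner_wedge_wedge:
  "mink_inner (mink_wedge x y z) (mink_wedge x y z) =
    - (mink_inner x x * (mink_inner y y * mink_inner z z - (mink_inner y z)\<^sup>2)
     - mink_inner x y * (mink_inner x y * mink_inner z z - mink_inner y z * mink_inner x z)
     + mink_inner x z * (mink_inner x y * mink_inner y z - mink_inner y y * mink_inner x z))"
  unfolding mink_wedge_eq by (simp add: mink_inner_def vector_def power2_eq_square) algebra

section \<open>Rotating the normal frame\<close>

lemma mink_inner_linear:
  "mink_inner (x + y) z = mink_inner x z + mink_inner y z"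
  "mink_inner z (x + y) = mink_inner z x + mink_inner z y"
  "mink_inner (x - y) z = mink_inner x z - mink_inner y z"
  "mink_inner z (x - y) = mink_inner z x - mink_inner z y"
  "mink_inner (r *\<^sub>R x) y = r * mink_inner x y"
  "mink_inner y (r *\<^sub>R x) = r * mink_inner y x"
  by (simp_all add: mink_inner_def algebra_simps)

lemma mink_inner_commute: "mink_inner x y = mink_inner y x"
  by (simp add: mink_inner_def algebra_simps)

text \<open>The condition on \<open>\<theta>\<close> makes \<open>cos \<theta> \<nu>\<^sub>1 - sin \<theta> \<nu>\<^sub>2\<close> orthogonal to \<open>D x\<close>.  The second normal
  is sought in the plane spanned by the other rotated vector and \<open>\<nu>\<^sub>3\<close>; \<open>\<kappa>\<close> and \<open>\<mu>\<close> are its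
  coordinates there, subject to having length one and being orthogonal to the coordinates of
  \<open>D x\<close>.\<close>

lemma hyperbolic_framed_base_curve_familyI:
  assumes "open V" "V \<subseteq> U"
    and surface: "hyperbolic_generalized_framed_surface U x \<nu>\<^sub>1 \<nu>\<^sub>2"
    and invariants: "basic_invariants_wrt D U x \<nu>\<^sub>1 \<nu>\<^sub>2 a b c e f g"
    and "smooth_on V \<theta>" "smooth_on V \<kappa>" "smooth_on V \<mu>"
    and \<theta>: "\<And>p. p \<in> V \<Longrightarrow> a p * cos (\<theta> p) - b p * sin (\<theta> p) = 0"
    and unit: "\<And>p. p \<in> V \<Longrightarrow> (\<kappa> p)\<^sup>2 + (\<mu> p)\<^sup>2 = 1"
    and orth: "\<And>p. p \<in> V \<Longrightarrow> \<kappa> p * (a p * sin (\<theta> p) + b p * cos (\<theta> p)) + \<mu> p * c p = 0"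
  shows "hyperbolic_framed_base_curve_family D V x"
proof -
  define \<nu>\<^sub>3 where "\<nu>\<^sub>3 = framed_surface_normal3 x \<nu>\<^sub>1 \<nu>\<^sub>2"
  define n\<^sub>1 where "n\<^sub>1 p = cos (\<theta> p) *\<^sub>R \<nu>\<^sub>1 p - sin (\<theta> p) *\<^sub>R \<nu>\<^sub>2 p" for p
  define m where "m p = sin (\<theta> p) *\<^sub>R \<nu>\<^sub>1 p + cos (\<theta> p) *\<^sub>R \<nu>\<^sub>2 p" for p
  define n\<^sub>2 where "n\<^sub>2 p = \<kappa> p *\<^sub>R m p + \<mu> p *\<^sub>R \<nu>\<^sub>3 p" for p
  have smooth: "smooth_on V x" "smooth_on V \<nu>\<^sub>1" "smooth_on V \<nu>\<^sub>2"
    using surface smooth_on_subset[OF _ \<open>V \<subseteq> U\<close>]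
    unfolding hyperbolic_generalized_framed_surface_def by blast+
  have "smooth_on V \<nu>\<^sub>3"
    unfolding \<nu>\<^sub>3_def framed_surface_normal3_def[abs_def]
    by (intro smooth_on_mink_wedge smooth \<open>open V\<close>)
  note trig = smooth_on_sin_cos[OF \<open>open V\<close> \<open>smooth_on V \<theta>\<close>]
  have "smooth_on V n\<^sub>1"
    unfolding n\<^sub>1_def[abs_def] by (intro smooth_on_diff smooth_on_scaleR trig smooth \<open>open V\<close>)
  moreover have "smooth_on V m"
    unfolding m_def[abs_def] by (intro smooth_on_add smooth_on_scaleR trig smooth \<open>open V\<close>)
  then have "smooth_on V n\<^sub>2"
    unfolding n\<^sub>2_def[abs_def]
    by (intro smooth_on_add smooth_on_scaleR assms(6,7) \<open>smooth_on V \<nu>\<^sub>3\<close> \<open>open V\<close>)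
  moreover have "x p \<in> hyperbolic_3_space \<and> (n\<^sub>1 p, n\<^sub>2 p) \<in> Delta5 \<and>
      mink_inner (x p) (n\<^sub>1 p) = 0 \<and> mink_inner (x p) (n\<^sub>2 p) = 0 \<and>
      mink_inner (D x p) (n\<^sub>1 p) = 0 \<and> mink_inner (D x p) (n\<^sub>2 p) = 0" if "p \<in> V" for p
  proof -
    have "p \<in> U"
      using \<open>p \<in> V\<close> \<open>V \<subseteq> U\<close> by blast
    then have x: "x p \<in> hyperbolic_3_space"
      and "(\<nu>\<^sub>1 p, \<nu>\<^sub>2 p) \<in> Delta5" "mink_inner (x p) (\<nu>\<^sub>1 p) = 0" "mink_inner (x p) (\<nu>\<^sub>2 p) = 0"
      using surface unfolding hyperbolic_generalized_framed_surface_def by blast+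
    then have frame: "mink_inner (x p) (x p) = -1" "mink_inner (\<nu>\<^sub>1 p) (\<nu>\<^sub>1 p) = 1"
      "mink_inner (\<nu>\<^sub>2 p) (\<nu>\<^sub>2 p) = 1" "mink_inner (\<nu>\<^sub>1 p) (\<nu>\<^sub>2 p) = 0" "mink_inner (\<nu>\<^sub>2 p) (\<nu>\<^sub>1 p) = 0"
      "mink_inner (x p) (\<nu>\<^sub>1 p) = 0" "mink_inner (x p) (\<nu>\<^sub>2 p) = 0"
      by (simp_all add: hyperbolic_3_space_def Delta5_def de_sitter_3_space_def mink_inner_commute)
    have normal: "mink_inner (x p) (\<nu>\<^sub>3 p) = 0" "mink_inner (\<nu>\<^sub>1 p) (\<nu>\<^sub>3 p) = 0"
      "mink_inner (\<nu>\<^sub>2 p) (\<nu>\<^sub>3 p) = 0" "mink_inner (\<nu>\<^sub>3 p) (\<nu>\<^sub>1 p) = 0" "mink_inner (\<nu>\<^sub>3 p) (\<nu>\<^sub>2 p) = 0"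
      "mink_inner (\<nu>\<^sub>3 p) (\<nu>\<^sub>3 p) = 1"
      using frame mink_inner_commute[of "\<nu>\<^sub>3 p"]
      by (simp_all add: \<nu>\<^sub>3_def framed_surface_normal3_def mink_inner_wedge_self mink_inner_wedge_wedge)
    note inner = mink_inner_linear frame normal
    have Dx: "D x p = a p *\<^sub>R \<nu>\<^sub>1 p + b p *\<^sub>R \<nu>\<^sub>2 p + c p *\<^sub>R \<nu>\<^sub>3 p"
      using invariants \<open>p \<in> U\<close> by (simp add: basic_invariants_wrt_def Let_def \<nu>\<^sub>3_def)
    have m: "mink_inner (m p) (m p) = 1" "mink_inner (n\<^sub>1 p) (m p) = 0" "mink_inner (x p) (m p) = 0"
      "mink_inner (m p) (\<nu>\<^sub>3 p) = 0" "mink_inner (\<nu>\<^sub>3 p) (m p) = 0" "mink_inner (n\<^sub>1 p) (\<nu>\<^sub>3 p) = 0"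
      "mink_inner (D x p) (m p) = a p * sin (\<theta> p) + b p * cos (\<theta> p)"
      "mink_inner (D x p) (\<nu>\<^sub>3 p) = c p"
      by (simp_all add: m_def n\<^sub>1_def Dx inner flip: power2_eq_square)
    have "(n\<^sub>1 p, n\<^sub>2 p) \<in> Delta5"
      using unit[OF \<open>p \<in> V\<close>]
      by (simp add: Delta5_def de_sitter_3_space_def n\<^sub>2_def inner m power2_eq_square)
        (simp add: n\<^sub>1_def inner flip: power2_eq_square)
    moreover have "mink_inner (x p) (n\<^sub>1 p) = 0" "mink_inner (D x p) (n\<^sub>1 p) = 0"
      using \<theta>[OF \<open>p \<in> V\<close>] by (simp_all add: n\<^sub>1_def Dx inner algebra_simps)
    moreover have "mink_inner (x p) (n\<^sub>2 p) = 0" "mink_inner (D x p) (n\<^sub>2 p) = 0"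
      using orth[OF \<open>p \<in> V\<close>] by (simp_all add: n\<^sub>2_def inner m)
    ultimately show ?thesis
      using x by simp
  qed
  ultimately show ?thesis
    using smooth(1)
    unfolding hyperbolic_framed_base_curve_family_def hyperbolic_framed_curve_family_def by blast
qed

text \<open>The unit vector \<open>(\<kappa>, \<mu>)\<close> orthogonal to \<open>(l, c)\<close> with \<open>l = a sin \<theta> + b cos \<theta>\<close> is \<open>(0, 1)\<close> if
  \<open>c\<close> vanishes identically, and a normalization of \<open>(c, -l)\<close> where \<open>c\<close> does not vanish.\<close>

lemma generalized_framed_surface_framed_base_curves:
  assumes "open U"
    and surface: "hyperbolic_generalized_framed_surface U x \<nu>\<^sub>1 \<nu>\<^sub>2"
    and invariants: "basic_invariants_wrt D U x \<nu>\<^sub>1 \<nu>\<^sub>2 a b c e f g"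
    and "smooth_on U \<theta>"
    and \<theta>: "\<And>p. p \<in> U \<Longrightarrow> a p * cos (\<theta> p) - b p * sin (\<theta> p) = 0"
  shows "(\<And>p. p \<in> U \<Longrightarrow> c p = 0) \<Longrightarrow> hyperbolic_framed_base_curve_family D U x"
    and "p\<^sub>0 \<in> U \<Longrightarrow> c p\<^sub>0 \<noteq> 0 \<Longrightarrow> hyperbolic_framed_base_curve_family_near D U x p\<^sub>0"
proof -
  assume "\<And>p. p \<in> U \<Longrightarrow> c p = 0"
  then show "hyperbolic_framed_base_curve_family D U x"
    by (intro hyperbolic_framed_base_curve_familyI[OF \<open>open U\<close> order_refl surface invariants
          \<open>smooth_on U \<theta>\<close>, where \<kappa> = "\<lambda>p. 0" and \<mu> = "\<lambda>p. 1"])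
      (simp_all add: \<theta> smooth_on_const \<open>open U\<close>)
next
  assume "p\<^sub>0 \<in> U" "c p\<^sub>0 \<noteq> 0"
  define V where "V = {p \<in> U. c p \<noteq> 0}"
  define l where "l p = a p * sin (\<theta> p) + b p * cos (\<theta> p)" for p
  define r where "r p = ((c p)\<^sup>2 + (l p)\<^sup>2) powr (-1/2)" for p
  have coeffs: "smooth_on U a" "smooth_on U b" "smooth_on U c"
    using invariants by (simp_all add: basic_invariants_wrt_def)
  have "open V"
    using continuous_open_preimage[OF smooth_on_imp_continuous_on[OF coeffs(3)] \<open>open U\<close>, of "- {0}"]
    by (simp add: V_def vimage_def Int_def open_Compl)
  have "V \<subseteq> U"
    by (auto simp: V_def)
  note smooth = smooth_on_subset[OF _ \<open>V \<subseteq> U\<close>]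
  have "smooth_on V \<theta>" "smooth_on V c"
    using smooth \<open>smooth_on U \<theta>\<close> coeffs by blast+
  have "smooth_on V l"
    unfolding l_def[abs_def]
    by (intro smooth_on_add smooth_on_mult smooth_on_sin_cos smooth coeffs \<open>open V\<close> \<open>smooth_on U \<theta>\<close>)
  have pos: "(c p)\<^sup>2 + (l p)\<^sup>2 > 0" if "p \<in> V" for p
    using that by (simp add: V_def add_pos_nonneg)
  have "smooth_on V r"
    unfolding r_def[abs_def]
    by (rule smooth_on_powr[OF \<open>open V\<close> _ pos])
      (unfold power2_eq_square, intro smooth_on_add smooth_on_mult \<open>open V\<close> \<open>smooth_on V c\<close> \<open>smooth_on V l\<close>)
  have "(r p)\<^sup>2 * ((c p)\<^sup>2 + (l p)\<^sup>2) = 1" if "p \<in> V" for p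
    using less_imp_neq[OF pos[OF that]]
    by (simp add: r_def powr_minus powr_half_sqrt power_inverse)
  then have unit: "(r p * c p)\<^sup>2 + (- (r p * l p))\<^sup>2 = 1" if "p \<in> V" for p
    using that by (simp add: power_mult_distrib distrib_left)
  have "hyperbolic_framed_base_curve_family D V x"
  proof (rule hyperbolic_framed_base_curve_familyI[OF \<open>open V\<close> \<open>V \<subseteq> U\<close> surface invariants
        \<open>smooth_on V \<theta>\<close> _ _ _ unit])
    show "smooth_on V (\<lambda>p. r p * c p)" "smooth_on V (\<lambda>p. - (r p * l p))"
      by (intro smooth_on_minus smooth_on_mult \<open>open V\<close> \<open>smooth_on V r\<close> \<open>smooth_on V c\<close>
          \<open>smooth_on V l\<close>)+
    show "a p * cos (\<theta> p) - b p * sin (\<theta> p) = 0" if "p \<in> V" for p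
      using \<theta> that \<open>V \<subseteq> U\<close> by blast
    show "r p * c p * (a p * sin (\<theta> p) + b p * cos (\<theta> p)) + - (r p * l p) * c p = 0" for p
      by (simp flip: l_def)
  qed
  then show "hyperbolic_framed_base_curve_family_near D U x p\<^sub>0"
    using \<open>open V\<close> \<open>V \<subseteq> U\<close> \<open>p\<^sub>0 \<in> U\<close> \<open>c p\<^sub>0 \<noteq> 0\<close>
    by (auto simp: hyperbolic_framed_base_curve_family_near_def V_def)
qed

theorem proposition3p12:
  fixes U :: "(real \<times> real) set"
    and x \<nu>\<^sub>1 \<nu>\<^sub>2 :: "real \<times> real \<Rightarrow> real^4"
    and a\<^sub>1 b\<^sub>1 c\<^sub>1 e\<^sub>1 f\<^sub>1 g\<^sub>1 a\<^sub>2 b\<^sub>2 c\<^sub>2 e\<^sub>2 f\<^sub>2 g\<^sub>2 :: "real \<times> real \<Rightarrow> real"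
  assumes "open U" and "simply_connected U"
    and "hyperbolic_generalized_framed_surface U x \<nu>\<^sub>1 \<nu>\<^sub>2"
    and "basic_invariants_wrt partial_u U x \<nu>\<^sub>1 \<nu>\<^sub>2 a\<^sub>1 b\<^sub>1 c\<^sub>1 e\<^sub>1 f\<^sub>1 g\<^sub>1"
    and "basic_invariants_wrt partial_v U x \<nu>\<^sub>1 \<nu>\<^sub>2 a\<^sub>2 b\<^sub>2 c\<^sub>2 e\<^sub>2 f\<^sub>2 g\<^sub>2"
  shows
    "((\<exists>\<theta> :: real \<times> real \<Rightarrow> real. smooth_on U \<theta> \<and>
         (\<forall>p\<in>U. a\<^sub>1 p * cos (\<theta> p) - b\<^sub>1 p * sin (\<theta> p) = 0)) \<longrightarrow>
      ((\<forall>p\<in>U. c\<^sub>1 p = 0) \<longrightarrow> hyperbolic_framed_base_curve_family partial_u U x) \<and>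
      (\<forall>p\<^sub>0\<in>U. c\<^sub>1 p\<^sub>0 \<noteq> 0 \<longrightarrow> hyperbolic_framed_base_curve_family_near partial_u U x p\<^sub>0)) \<and>
     ((\<exists>\<theta> :: real \<times> real \<Rightarrow> real. smooth_on U \<theta> \<and>
         (\<forall>p\<in>U. a\<^sub>2 p * cos (\<theta> p) - b\<^sub>2 p * sin (\<theta> p) = 0)) \<longrightarrow>
      ((\<forall>p\<in>U. c\<^sub>2 p = 0) \<longrightarrow> hyperbolic_framed_base_curve_family partial_v U x) \<and>
      (\<forall>p\<^sub>0\<in>U. c\<^sub>2 p\<^sub>0 \<noteq> 0 \<longrightarrow> hyperbolic_framed_base_curve_family_near partial_v U x p\<^sub>0))"
  using generalized_framed_surface_framed_base_curves[OF assms(1,3,4)]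
    generalized_framed_surface_framed_base_curves[OF assms(1,3,5)]
  by blast

end
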